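(* Let $\Sigma$ be a 2-dimensional manifold and let $F:\Sigma\to\mathbb{P}(\mathcal{L})\cong\mathbb{S}^{3}$ be an umbilic-free immersion into the conformal 3-sphere, where $\mathcal{L}$ is the light cone of $\mathbb{R}^{4,1}$. Then $F$ is $\mathrm{O}(4,1)$-rigid to third order, i.e. $F$ admits no non-trivial third order $\mathrm{O}(4,1)$-deformation.
   Context: $\mathrm{O}(4,1)$ acts on $\mathbb{R}^{4,1}$ and hence on the projective light cone $\mathbb{P}(\mathcal{L})\subset\mathbb{P}(\mathbb{R}^{4,1})$, identified with the conformal 3-sphere $\mathbb{S}^{3}$. A map $\hat{F}:\Sigma\to\mathbb{P}(\mathcal{L})$ is a third order $\mathrm{O}(4,1)$-deformation of $F$ if there is a smooth $g:\Sigma\to\mathrm{O}(4,1)$ such that for every $p\in\Sigma$ the maps $g^{-1}(p)\hat{F}$ (with $g^{-1}(p)$ a fixed group element) and $F$ agree to order 3 at $p$ (same 3-jet at $p$). It is trivial if $\hat{F}=AF$ for some constant $A\in\mathrm{O}(4,1)$. $F$ is umbilic-free if at no point is its second fundamental form (with respect to any metric in the conformal class) a multiple of the induced metric.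
   Formalization: The manifold Σ is assumed connected; on a disconnected Σ the claim fails, since applying different constant elements of O(4,1) on different components gives a non-trivial third order deformation. *)

theory Defs
  imports "HOL-Analysis.Analysis"
begin

section \<open>Smooth maps and jets on open subsets of normed spaces\<close>

definition dir_deriv :: "'a::real_normed_vector \<Rightarrow> ('a \<Rightarrow> 'b::real_normed_vector) \<Rightarrow> 'a \<Rightarrow> 'b"
  where "dir_deriv v f = (\<lambda>x. frechet_derivative f (at x) v)"

primrec differentiable_times_on ::
    "nat \<Rightarrow> 'a set \<Rightarrow> ('a::real_normed_vector \<Rightarrow> 'b::real_normed_vector) \<Rightarrow> bool" where
  "differentiable_times_on 0 S f \<longleftrightarrow> continuous_on S f"
| "differentiable_times_on (Suc k) S f \<longleftrightarrow>
     (\<forall>x\<in>S. f differentiable (at x)) \<and> (\<forall>v. differentiable_times_on k S (dir_deriv v f))"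

text \<open>Only used for open \<open>S\<close>, since the derivatives are taken at points of the ambient space.\<close>
definition smooth_on :: "'a set \<Rightarrow> ('a::real_normed_vector \<Rightarrow> 'b::real_normed_vector) \<Rightarrow> bool"
  where "smooth_on S f \<longleftrightarrow> (\<forall>k. differentiable_times_on k S f)"

text \<open>Equality of \<open>k\<close>-jets: all iterated directional derivatives of order at most \<open>k\<close> agree at \<open>x\<close>.\<close>
primrec same_jet ::
    "nat \<Rightarrow> ('a::real_normed_vector \<Rightarrow> 'b::real_normed_vector) \<Rightarrow> ('a \<Rightarrow> 'b) \<Rightarrow> 'a \<Rightarrow> bool" where
  "same_jet 0 f g x \<longleftrightarrow> f x = g x"
| "same_jet (Suc k) f g x \<longleftrightarrow>
     f x = g x \<and> (\<forall>v. same_jet k (dir_deriv v f) (dir_deriv v g) x)"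


section \<open>Smooth surfaces\<close>

text \<open>A chart is a domain together with a coordinate map, whose values off the domain are irrelevant.\<close>
type_synonym 'a chart = "'a set \<times> ('a \<Rightarrow> real^2)"

definition coord_range :: "'a chart \<Rightarrow> (real^2) set"
  where "coord_range c = snd c ` fst c"

definition param :: "'a chart \<Rightarrow> real^2 \<Rightarrow> 'a"
  where "param c = inv_into (fst c) (snd c)"

definition is_chart :: "'a::topological_space chart \<Rightarrow> bool"
  where "is_chart c \<longleftrightarrow> open (fst c) \<and> open (coord_range c) \<and>
           homeomorphism (fst c) (coord_range c) (snd c) (param c)"

text \<open>The underlying set of the surface is the whole type; the atlas need not be maximal.\<close>
definition smooth_surface :: "'a::{t2_space, second_countable_topology} chart set \<Rightarrow> bool"
  where "smooth_surface \<A> \<longleftrightarrow>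
           (\<forall>c\<in>\<A>. is_chart c) \<and> (\<Union>c\<in>\<A>. fst c) = UNIV \<and>
           (\<forall>c\<in>\<A>. \<forall>d\<in>\<A>. smooth_on (snd c ` (fst c \<inter> fst d)) (snd d \<circ> param c))"

definition smooth_map :: "'a chart set \<Rightarrow> ('a \<Rightarrow> 'b::real_normed_vector) \<Rightarrow> bool"
  where "smooth_map \<A> f \<longleftrightarrow> (\<forall>c\<in>\<A>. smooth_on (coord_range c) (f \<circ> param c))"


section \<open>The conformal 3-sphere\<close>

text \<open>The fifth coordinate is timelike. (The index type \<open>5\<close> has the elements \<open>1, 2, 3, 4, 5\<close>,
  where \<open>5 = 0\<close>.)\<close>
definition mink :: "real^5 \<Rightarrow> real^5 \<Rightarrow> real"
  where "mink x y = (\<Sum>i\<in>UNIV - {5}. x $ i * y $ i) - x $ 5 * y $ 5"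

definition O41 :: "(real^5^5) set"
  where "O41 = {A. \<forall>x y. mink (A *v x) (A *v y) = mink x y}"

definition light_cone :: "(real^5) set"
  where "light_cone = {v. v \<noteq> 0 \<and> mink v v = 0}"

text \<open>Points of projective space are one-dimensional linear subspaces.\<close>
definition proj_light_cone :: "(real^5) set set"
  where "proj_light_cone = (\<lambda>v. span {v}) ` light_cone"

definition act :: "real^5^5 \<Rightarrow> (real^5) set \<Rightarrow> (real^5) set"
  where "act A l = (\<lambda>v. A *v v) ` l"

text \<open>A nonzero null vector has nonzero fifth coordinate, so the projective light cone lies in
  the domain of the affine chart of projective 4-space given by \<open>v $ 5 = 1\<close>; \<open>aff\<close> is this
  chart. Its image is the unit sphere \<open>v\<^sub>1\<^sup>2 + v\<^sub>2\<^sup>2 + v\<^sub>3\<^sup>2 + v\<^sub>4\<^sup>2 = 1\<close> in that hyperplane, which is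
  the identification with the 3-sphere. Smoothness, derivatives and jets of maps into
  the projective light cone are taken in this chart.\<close>
definition aff :: "(real^5) set \<Rightarrow> real^5"
  where "aff l = (THE v. v \<in> l \<and> v $ 5 = 1)"

definition smooth_map_PL :: "'a chart set \<Rightarrow> ('a \<Rightarrow> (real^5) set) \<Rightarrow> bool"
  where "smooth_map_PL \<A> F \<longleftrightarrow> (\<forall>p. F p \<in> proj_light_cone) \<and> smooth_map \<A> (aff \<circ> F)"

definition immersion_PL :: "'a chart set \<Rightarrow> ('a \<Rightarrow> (real^5) set) \<Rightarrow> bool"
  where "immersion_PL \<A> F \<longleftrightarrow> smooth_map_PL \<A> F \<and>
           (\<forall>c\<in>\<A>. \<forall>x\<in>coord_range c. inj (frechet_derivative (aff \<circ> F \<circ> param c) (at x)))"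


section \<open>Umbilics\<close>

text \<open>A metric in the conformal class is \<open>exp (2 * u)\<close> times the round metric, for a smooth
  function \<open>u\<close> on the sphere. It is the metric induced by \<open>mink\<close> on the
  section \<open>v \<mapsto> exp (u v) *\<^sub>R v\<close> of the light cone, \<open>v\<close> ranging over the unit sphere
  in \<open>v $ 5 = 1\<close>. Smooth functions on that sphere are the restrictions of smooth functions on
  the ambient space, so \<open>u\<close> is taken to be defined there.\<close>
definition cone_section :: "(real^5 \<Rightarrow> real) \<Rightarrow> real^5 \<Rightarrow> real^5"
  where "cone_section u v = exp (u v) *\<^sub>R v"

definition section_tangent :: "(real^5 \<Rightarrow> real) \<Rightarrow> real^5 \<Rightarrow> (real^5) set"
  where "section_tangent u v =
           (\<lambda>w. dir_deriv w (cone_section u) v) ` {w. w $ 5 = 0 \<and> mink v w = 0}"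

definition section_lift ::
    "(real^5 \<Rightarrow> real) \<Rightarrow> ('a \<Rightarrow> (real^5) set) \<Rightarrow> 'a chart \<Rightarrow> real^2 \<Rightarrow> real^5"
  where "section_lift u F c = cone_section u \<circ> aff \<circ> F \<circ> param c"

definition first_ff ::
    "(real^5 \<Rightarrow> real) \<Rightarrow> ('a \<Rightarrow> (real^5) set) \<Rightarrow> 'a chart \<Rightarrow> real^2 \<Rightarrow> real^2 \<Rightarrow> real^2 \<Rightarrow> real"
  where "first_ff u F c x a b =
           mink (dir_deriv a (section_lift u F c) x) (dir_deriv b (section_lift u F c) x)"

definition unit_normal ::
    "(real^5 \<Rightarrow> real) \<Rightarrow> ('a \<Rightarrow> (real^5) set) \<Rightarrow> 'a chart \<Rightarrow> real^2 \<Rightarrow> real^5 \<Rightarrow> bool"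
  where "unit_normal u F c x n \<longleftrightarrow>
           n \<in> section_tangent u (aff (F (param c x))) \<and> mink n n = 1 \<and>
           (\<forall>a. mink (dir_deriv a (section_lift u F c) x) n = 0)"

text \<open>The Levi-Civita connection of the section is the \<open>mink\<close>-orthogonal projection of the flat
  one to the tangent spaces of the section. As \<open>n\<close> is tangent to the section, pairing the
  flat second derivative with \<open>n\<close> gives the second fundamental form.\<close>
definition second_ff ::
    "(real^5 \<Rightarrow> real) \<Rightarrow> ('a \<Rightarrow> (real^5) set) \<Rightarrow> 'a chart \<Rightarrow> real^2 \<Rightarrow> real^5 \<Rightarrow> real^2 \<Rightarrow> real^2 \<Rightarrow> real"
  where "second_ff u F c x n a b =
           mink (dir_deriv a (dir_deriv b (section_lift u F c)) x) n"

text \<open>The unit normal of an immersion is unique up to sign, so its choice does not matter.\<close>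
definition umbilic_at ::
    "(real^5 \<Rightarrow> real) \<Rightarrow> ('a \<Rightarrow> (real^5) set) \<Rightarrow> 'a chart \<Rightarrow> real^2 \<Rightarrow> bool"
  where "umbilic_at u F c x \<longleftrightarrow>
           (\<exists>n k. unit_normal u F c x n \<and> (\<forall>a b. second_ff u F c x n a b = k * first_ff u F c x a b))"

text \<open>Being umbilic depends neither on the chart nor on the metric in the conformal class.\<close>
definition umbilic_free :: "'a chart set \<Rightarrow> ('a \<Rightarrow> (real^5) set) \<Rightarrow> bool"
  where "umbilic_free \<A> F \<longleftrightarrow>
           (\<forall>u. smooth_on UNIV u \<longrightarrow> (\<forall>c\<in>\<A>. \<forall>x\<in>coord_range c. \<not> umbilic_at u F c x))"


section \<open>Deformations\<close>

definition agree_to_order ::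
    "nat \<Rightarrow> 'a chart set \<Rightarrow> ('a \<Rightarrow> (real^5) set) \<Rightarrow> ('a \<Rightarrow> (real^5) set) \<Rightarrow> 'a \<Rightarrow> bool"
  where "agree_to_order k \<A> F G p \<longleftrightarrow>
           (\<forall>c\<in>\<A>. p \<in> fst c \<longrightarrow> same_jet k (aff \<circ> F \<circ> param c) (aff \<circ> G \<circ> param c) (snd c p))"

definition O41_deformation ::
    "nat \<Rightarrow> 'a chart set \<Rightarrow> ('a \<Rightarrow> (real^5) set) \<Rightarrow> ('a \<Rightarrow> (real^5) set) \<Rightarrow> bool"
  where "O41_deformation k \<A> F Fhat \<longleftrightarrow>
           smooth_map_PL \<A> Fhat \<and>
           (\<exists>g. smooth_map \<A> g \<and> (\<forall>p. g p \<in> O41) \<and>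
                (\<forall>p. agree_to_order k \<A> (\<lambda>q. act (matrix_inv (g p)) (Fhat q)) F p))"

definition trivial_deformation :: "('a \<Rightarrow> (real^5) set) \<Rightarrow> ('a \<Rightarrow> (real^5) set) \<Rightarrow> bool"
  where "trivial_deformation F Fhat \<longleftrightarrow> (\<exists>A\<in>O41. \<forall>p. Fhat p = act A (F p))"

definition O41_rigid :: "nat \<Rightarrow> 'a chart set \<Rightarrow> ('a \<Rightarrow> (real^5) set) \<Rightarrow> bool"
  where "O41_rigid k \<A> F \<longleftrightarrow>
           \<not> (\<exists>Fhat. O41_deformation k \<A> F Fhat \<and> \<not> trivial_deformation F Fhat)"

end

theory Submission
  imports Defs
begin

text \<open>Let \<open>G\<close> be the inverse of the moving isometry and \<open>f\<close>, \<open>k\<close> the lifts of \<open>F\<close>, \<open>Fhat\<close> in a chart.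
  Contact of order 3 at \<open>x\<close> means that \<open>G(x) k\<close> and a multiple of \<open>f\<close> have the same 3-jet at \<open>x\<close>.
  Letting \<open>x\<close> vary and differentiating costs one order: the Lie algebra element
  \<open>dG G\<^sup>-\<^sup>1\<close>, as a conformal vector field, fixes the 2-jet of \<open>f\<close> at \<open>x\<close>. The Lie algebra stabilizer of
  the 2-jet of an immersion is trivial, so \<open>dG = 0\<close>, and \<open>G\<close> is constant by connectedness.\<close>

section \<open>Linear algebra of the Lorentz form\<close>

lemma mink_inner: "mink x y = x \<bullet> y - 2 * (x $ 5 * y $ 5)"
proof -
  have "x \<bullet> y = x $ 5 * y $ 5 + (\<Sum>i\<in>UNIV - {5}. x $ i * y $ i)"
    unfolding inner_vec_def inner_real_def by (rule sum.remove) auto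
  then show ?thesis
    unfolding mink_def by simp
qed

lemma mink_bounded_bilinear: "bounded_bilinear mink"
  unfolding bilinear_conv_bounded_bilinear[symmetric] bilinear_def mink_inner
  by (auto intro!: linearI simp: algebra_simps)

interpretation mink: bounded_bilinear mink
  by (rule mink_bounded_bilinear)

lemma mink_commute: "mink x y = mink y x"
  by (simp add: mink_inner inner_commute mult.commute)

text \<open>Pairing with the time axis gives minus \<open>x $ 5\<close>; once that vanishes, pairing
  \<open>x\<close> with itself is the squared Euclidean norm.\<close>

lemma mink_nondegenerate:
  assumes "\<And>y. mink x y = 0"
  shows "x = 0"
proof -
  have 5: "x $ 5 = 0"
    using assms[of "axis 5 1"] by (simp add: mink_inner inner_axis)
  show ?thesis
    using assms[of x] 5 by (simp add: mink_inner)
qed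

lemma mink_spatial_eq_0: "w $ 5 = 0 \<Longrightarrow> mink w w = 0 \<longleftrightarrow> w = 0"
  by (simp add: mink_inner)

text \<open>Removing the multiple \<open>u $ 5\<close> of \<open>p\<close> leaves a spatial vector
  with the same square as \<open>u\<close>. So the form is semidefinite on the orthogonal complement
  of \<open>p\<close>, with radical the line of \<open>p\<close>.\<close>

lemma mink_orthogonal_null:
  assumes p: "p $ 5 = 1" "mink p p = 0" and u: "mink u p = 0"
  shows "mink u u = 0 \<longleftrightarrow> u = u $ 5 *\<^sub>R p"
proof -
  define w where "w = u - u $ 5 *\<^sub>R p"
  have w: "w $ 5 = 0"
    by (simp add: w_def p)
  have "mink w w = mink u u"
    using p u by (simp add: w_def mink.diff_left mink.diff_right mink.scaleR_left
        mink.scaleR_right mink_commute[of p u])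
  then show ?thesis
    using mink_spatial_eq_0[OF w] by (simp add: w_def)
qed

section \<open>Adjoints and inverses for the Lorentz form\<close>

definition mink_sign :: "5 \<Rightarrow> real"
  where "mink_sign i = (if i = 5 then -1 else 1)"

text \<open>With J the diagonal matrix of signs this is J A^T J, the adjoint for
  \<open>mink\<close>. It is linear in \<open>A\<close> and equals the inverse on
  \<open>O41\<close>, so inverting a moving isometry preserves smoothness.\<close>

definition mink_adjoint :: "real^5^5 \<Rightarrow> real^5^5"
  where "mink_adjoint A = (\<chi> i j. mink_sign i * mink_sign j * A $ j $ i)"

lemma mink_sum: "mink x y = (\<Sum>i\<in>UNIV. mink_sign i * x $ i * y $ i)"
proof -
  have "(\<Sum>i\<in>UNIV. mink_sign i * x $ i * y $ i) =
      mink_sign 5 * x $ 5 * y $ 5 + (\<Sum>i\<in>UNIV - {5}. mink_sign i * x $ i * y $ i)"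
    by (rule sum.remove) auto
  also have "(\<Sum>i\<in>UNIV - {5}. mink_sign i * x $ i * y $ i) = (\<Sum>i\<in>UNIV - {5}. x $ i * y $ i)"
    by (rule sum.cong) (auto simp: mink_sign_def)
  finally show ?thesis
    by (simp add: mink_def mink_sign_def)
qed

lemma mink_adjoint_mult: "mink (mink_adjoint A *v x) y = mink x (A *v y)"
proof -
  have s: "mink_sign i * mink_sign i = 1" for i
    by (simp add: mink_sign_def)
  have "mink (mink_adjoint A *v x) y =
      (\<Sum>i\<in>UNIV. \<Sum>j\<in>UNIV. (mink_sign i * mink_sign i) * (mink_sign j * x $ j * A $ j $ i * y $ i))"
    unfolding mink_sum
    by (simp add: matrix_vector_mult_def mink_adjoint_def sum_distrib_left sum_distrib_right mult_ac)
  also have "\<dots> = (\<Sum>j\<in>UNIV. \<Sum>i\<in>UNIV. mink_sign j * x $ j * A $ j $ i * y $ i)"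
    unfolding s by (subst sum.swap) simp
  also have "\<dots> = mink x (A *v y)"
    unfolding mink_sum
    by (simp add: matrix_vector_mult_def sum_distrib_left mult_ac)
  finally show ?thesis .
qed

lemma bounded_linear_mink_adjoint: "bounded_linear mink_adjoint"
  unfolding linear_conv_bounded_linear[symmetric]
  by (rule linearI) (simp_all add: mink_adjoint_def vec_eq_iff algebra_simps)

text \<open>For an isometry <A* A x, y> = <A x, A y> = <x, y>, and nondegeneracy gives A* A = 1.
  One-sided inverses of square matrices are two-sided and unique.\<close>

lemma O41_inverse:
  assumes A: "A \<in> O41"
  shows "matrix_inv A = mink_adjoint A"
    and "mink_adjoint A ** A = mat 1" and "A ** mink_adjoint A = mat 1"
proof -
  have "(mink_adjoint A ** A) *v x = x" for x
  proof -
    have "mink (mink_adjoint A *v (A *v x) - x) y = 0" for y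
      using A by (simp add: mink.diff_left mink_adjoint_mult O41_def)
    from mink_nondegenerate[OF this] show ?thesis
      by (simp add: matrix_vector_mul_assoc)
  qed
  then show *: "mink_adjoint A ** A = mat 1"
    by (simp add: matrix_eq)
  then show **: "A ** mink_adjoint A = mat 1"
    by (simp add: matrix_left_right_inverse)
  have "\<exists>A'. A ** A' = mat 1 \<and> A' ** A = mat 1"
    using * ** by blast
  then have "A ** matrix_inv A = mat 1 \<and> matrix_inv A ** A = mat 1"
    unfolding matrix_inv_def by (rule someI_ex)
  then have "mink_adjoint A ** (A ** matrix_inv A) = mink_adjoint A"
    by simp
  then show "matrix_inv A = mink_adjoint A"
    by (simp add: matrix_mul_assoc *)
qed

lemma O41_matrix_inv: "A \<in> O41 \<Longrightarrow> matrix_inv A \<in> O41"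
  by (simp add: O41_def O41_inverse(1) mink_adjoint_mult matrix_vector_mul_assoc O41_inverse(3))

lemma matrix_vector_bounded_bilinear:
  "bounded_bilinear ((*v) :: real^'n^'m \<Rightarrow> real^'n \<Rightarrow> real^'m)"
  unfolding bilinear_conv_bounded_bilinear[symmetric] bilinear_def
  by (auto intro!: linearI simp: algebra_simps vec_eq_iff matrix_vector_mult_def
      sum.distrib sum_distrib_left)

text \<open>The tangent vectors \<open>e v\<close>, together with \<open>p\<close> and \<open>q\<close>, span a nondegenerate hyperplane;
  its orthogonal complement is one-dimensional since otherwise \<open>real^5\<close> would contain a
  six-dimensional space.\<close>
lemma orthogonal_complement_dependent:
  fixes e :: "real^2 \<Rightarrow> real^5"
  assumes p: "p $ 5 = 1" "mink p p = 0"
    and e: "linear e" "\<And>v. mink (e v) p = 0" "\<And>v. v \<noteq> 0 \<Longrightarrow> mink (e v) (e v) \<noteq> 0"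
    and q: "mink q p \<noteq> 0"
    and u: "mink u p = 0" "\<And>v. mink u (e v) = 0" "mink u q = 0" "mink u u \<noteq> 0"
    and w: "mink w p = 0" "\<And>v. mink w (e v) = 0" "mink w q = 0"
  shows "\<exists>c. w = c *\<^sub>R u"
proof (rule ccontr)
  assume nex: "\<nexists>c. w = c *\<^sub>R u"
  \<comment> \<open>The orthogonal projection along \<open>u\<close>: the remainder
    \<open>w'\<close> is nonzero and orthogonal to \<open>u\<close> as well as to \<open>p\<close>,
    \<open>q\<close> and every \<open>e v\<close>.\<close>
  define c where "c = mink w u / mink u u"
  define w' where "w' = w - c *\<^sub>R u"
  have w': "mink w' p = 0" "\<And>v. mink w' (e v) = 0" "mink w' q = 0" "mink w' u = 0"
    using u w by (simp_all add: w'_def c_def mink.diff_left mink.scaleR_left)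
  have "w' \<noteq> 0"
    using nex by (auto simp: w'_def)
  have "mink w' w' \<noteq> 0"
  proof
    assume "mink w' w' = 0"
    then have *: "w' = w' $ 5 *\<^sub>R p"
      using mink_orthogonal_null[OF p w'(1)] by simp
    have "w' $ 5 * mink q p = mink w' q"
      by (subst (2) *) (simp add: mink.scaleR_left mink_commute[of p])
    then show False
      using * w'(3) q \<open>w' \<noteq> 0\<close> by auto
  qed
  \<comment> \<open>The domain has dimension 2 + 4 = 6, so injectivity is impossible in
    \<open>real^5\<close>.\<close>
  define T where "T = (\<lambda>(v, a, b, c, d). e v + a *\<^sub>R p + b *\<^sub>R q + c *\<^sub>R u + d *\<^sub>R w')"
  have lin: "linear T"
    using linear_add[OF e(1)] linear_scale[OF e(1)]
    by (auto intro!: linearI simp: T_def algebra_simps)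
  have "inj T"
  proof (subst linear_injective_0[OF lin], intro allI impI)
    fix x
    assume T0: "T x = 0"
    obtain v a b c d where x: "x = (v, a, b, c, d)"
      by (cases x) auto
    have m: "mink (e v) y + a * mink p y + b * mink q y + c * mink u y + d * mink w' y = 0" for y
      using T0 mink.zero_left[of y]
      by (simp add: x T_def mink.add_left mink.scaleR_left flip: \<open>T x = 0\<close>)
    note com = mink_commute[of "e _" u] mink_commute[of "e _" w'] mink_commute[of p u]
      mink_commute[of p w'] mink_commute[of q u] mink_commute[of q w'] mink_commute[of u w']
    \<comment> \<open>Pairing with \<open>u\<close>, \<open>w'\<close>, \<open>p\<close>,
      \<open>e v\<close>, \<open>q\<close> in this order isolates one unknown at a time; since
      \<open>p\<close> is null, its coefficient \<open>a\<close> only shows against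
      \<open>q\<close>.\<close>
    have "c = 0"
      using m[of u] u(4) by (simp add: u w' com)
    moreover have "d = 0"
      using m[of w'] \<open>mink w' w' \<noteq> 0\<close> by (simp add: u w' com)
    moreover have "b = 0"
      using m[of p] q by (simp add: p e u w')
    moreover have "v = 0"
      using m[of "e v"] e(3)[of v] \<open>b = 0\<close> by (auto simp: p e u w' mink_commute[of p])
    moreover have "a = 0"
      using m[of q] q by (simp add: mink_commute[of p q] \<open>b = 0\<close> \<open>v = 0\<close> \<open>c = 0\<close> \<open>d = 0\<close>
          linear_0[OF e(1)] mink.zero_left)
    ultimately show "x = 0"
      by (simp add: x zero_prod_def)
  qed
  then have "dim (range T) = DIM((real^2) \<times> real \<times> real \<times> real \<times> real)"
    using eucl.dim_image_eq[OF lin, of UNIV] by simp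
  moreover have "dim (range T) \<le> DIM(real^5)"
    by (rule dim_subset_UNIV)
  ultimately show False
    by simp
qed

text \<open>Here \<open>p\<close>, \<open>e v\<close>, \<open>q v\<close> are the derivatives of order 0, 1, 2 of the surface, \<open>k0\<close>, \<open>k1 v\<close>,
  \<open>k2 v\<close> those of its deformation, \<open>A\<close> is the moving isometry and \<open>B\<close> its derivative. The
  hypotheses on \<open>B\<close> say that the Lie algebra element \<open>B A\<^sup>-\<^sup>1\<close> stabilizes the 2-jet.\<close>
lemma infinitesimal_rigidity:
  fixes A B :: "real^5^5" and e q k1 k2 :: "real^2 \<Rightarrow> real^5"
  assumes skew: "\<And>x y. mink (B *v x) (A *v y) + mink (A *v x) (B *v y) = 0"
    and surj: "\<And>y. \<exists>x. A *v x = y"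
    and p: "p $ 5 = 1" "mink p p = 0"
    and e: "linear e" "\<And>v. mink (e v) p = 0" "\<And>v. v \<noteq> 0 \<Longrightarrow> mink (e v) (e v) \<noteq> 0"
    and q: "\<And>v. mink (q v) p = - mink (e v) (e v)"
    and L: "L \<noteq> 0"
    and A0: "A *v k0 = L *\<^sub>R p"
    and A1: "\<And>v. A *v k1 v = L *\<^sub>R e v + l1 v *\<^sub>R p"
    and A2: "\<And>v. A *v k2 v = L *\<^sub>R q v + (2 * l1 v) *\<^sub>R e v + l2 v *\<^sub>R p"
    and B0: "B *v k0 = a *\<^sub>R p"
    and B1: "\<And>v. B *v k1 v = a *\<^sub>R e v + b v *\<^sub>R p"
    and B2: "\<And>v. B *v k2 v = a *\<^sub>R q v + (2 * b v) *\<^sub>R e v + c v *\<^sub>R p"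
  shows "B = 0"
proof -
  note bil = mink.add_left mink.add_right mink.scaleR_left mink.scaleR_right
    mink_commute[of p "e _"] mink_commute[of p "q _"] e(2) p(2) q
  have e1: "mink (e v) (e v) \<noteq> 0" if "v \<noteq> 0" for v
    using e(3) that by blast
  define v :: "real^2" where "v = axis 1 1"
  have v: "v \<noteq> 0"
    by (simp add: v_def axis_eq_0_iff)
  \<comment> \<open>Skewness at \<open>k1 v\<close>, \<open>k1 v\<close> reads 2 a L <e v, e v> =
    0.\<close>
  have a: "a = 0"
    using skew[of "k1 v" "k1 v"] e1[OF v] L by (simp add: A1 B1 bil)
  \<comment> \<open>Pairing \<open>k1 x\<close> with \<open>k2 x\<close> gives (-1 + 2) b L <e x, e
    x> = 0, with -1 from <p, q x> and 2 from the cross terms in \<open>e x\<close>. At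
    \<open>x = 0\<close> this is void since \<open>e 0 = 0\<close>, so \<open>k1 0\<close> is paired
    with \<open>k2 v\<close> instead.\<close>
  have b: "b x = 0" for x
  proof (cases "x = 0")
    case True
    then show ?thesis
      using B0 B1[of 0] A1[of 0] A0 skew[of "k1 0" "k2 v"] e1[OF v] L
      by (simp add: A2 B2 bil a linear_0[OF e(1)] mink.zero_left mink.zero_right)
  next
    case False
    then show ?thesis
      using skew[of "k1 x" "k2 x"] e1[OF False] L
      by (simp add: A1 A2 B1 B2 bil a algebra_simps mink_commute[of "q x" "e x"])
  qed
  have c: "c v = 0"
    using skew[of "k2 v" "k2 v"] e1[OF v] L by (simp add: A2 B2 bil a b)
  \<comment> \<open>Now \<open>B\<close> kills \<open>k0\<close>, every \<open>k1 w\<close> and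
    \<open>k2 v\<close>, so by skewness its range is orthogonal to their images under
    \<open>A\<close>, hence to \<open>p\<close>, every \<open>e w\<close> and
    \<open>q v\<close>.\<close>
  have orth: "mink (B *v x) (A *v y) = 0" if "B *v y = 0" for x y
    using skew[of x y] that by (simp add: mink.zero_right)
  have orth_p: "mink (B *v x) p = 0" for x
    using orth[of k0 x] L by (simp add: B0 A0 a bil)
  have orth_e: "mink (B *v x) (e w) = 0" for x w
    using orth[of "k1 w" x] L by (simp add: B1 A1 a b bil orth_p)
  have orth_q: "mink (B *v x) (q v) = 0" for x
    using orth[of "k2 v" x] L by (simp add: B2 A2 a b c bil orth_p orth_e)
  have qp: "mink (q v) p \<noteq> 0"
    using q e1[OF v] by simp
  \<comment> \<open>The range of \<open>B\<close> lies in a line without nonzero null vectors. If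
    \<open>u = A *v y\<close> spans it, then \<open>B *v y\<close> is \<open>r\<close> times
    \<open>u\<close>, skewness gives \<open>r = 0\<close>, and then <u, u> = <B x, A y> = 0, a
    contradiction.\<close>
  have "B *v x = 0" for x
  proof (rule ccontr)
    define u where "u = B *v x"
    assume "B *v x \<noteq> 0"
    then have "u \<noteq> 0"
      by (simp add: u_def)
    have uu: "mink u u \<noteq> 0"
    proof
      assume "mink u u = 0"
      then have *: "u = u $ 5 *\<^sub>R p"
        using mink_orthogonal_null[OF p] orth_p by (simp add: u_def)
      have "u $ 5 * mink (q v) p = mink u (q v)"
        by (subst (2) *) (simp add: mink.scaleR_left mink_commute[of p])
      then show False
        using * orth_q qp \<open>u \<noteq> 0\<close> by (auto simp: u_def)
    qed
    obtain y where y: "A *v y = u"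
      using surj by blast
    obtain r where r: "B *v y = r *\<^sub>R u"
      using orthogonal_complement_dependent[OF p e qp, of u "B *v y"] orth_p orth_e orth_q uu
      by (auto simp: u_def)
    have "r = 0"
      using skew[of y y] uu by (simp add: y r mink.scaleR_left mink.scaleR_right)
    then show False
      using orth[of y x] r y uu by (simp add: u_def)
  qed
  then show ?thesis
    by (simp add: matrix_eq)
qed

section \<open>Iterated directional derivatives\<close>

lemma has_derivative_dir_deriv:
  "f differentiable (at x) \<Longrightarrow> (f has_derivative (\<lambda>v. dir_deriv v f x)) (at x)"
  unfolding dir_deriv_def frechet_derivative_works by simp

lemma dir_deriv_eq: "(f has_derivative f') (at x) \<Longrightarrow> dir_deriv v f x = f' v"
  unfolding dir_deriv_def using frechet_derivative_at by metis

text \<open>Uniqueness of the derivative, in the form used below to differentiate both sides of an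
  identity on an open set.\<close>

lemma has_derivative_eq_on_open:
  assumes "open U" "x \<in> U" "\<And>y. y \<in> U \<Longrightarrow> f y = g y"
    and "(f has_derivative f') (at x)" "(g has_derivative g') (at x)"
  shows "f' v = g' v"
  using has_derivative_unique[OF has_derivative_transform_within_open[OF assms(4,1,2,3)] assms(5)]
  by simp

text \<open>Differentiability is not assumed: \<open>frechet_derivative\<close> is a choice from a
  predicate that depends only on the germ, so both choices coincide.\<close>

lemma dir_deriv_cong:
  assumes "open U" "x \<in> U" "\<And>y. y \<in> U \<Longrightarrow> f y = g y"
  shows "dir_deriv v f x = dir_deriv v g x"
proof -
  have "(f has_derivative D) (at x) \<longleftrightarrow> (g has_derivative D) (at x)" for D
    using has_derivative_transform_within_open[of f D x UNIV U g]
      has_derivative_transform_within_open[of g D x UNIV U f] assms by auto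
  then show ?thesis
    by (simp add: dir_deriv_def frechet_derivative_def)
qed

lemma differentiable_cong_open:
  assumes "open U" "x \<in> U" "\<And>y. y \<in> U \<Longrightarrow> f y = g y" "f differentiable (at x)"
  shows "g differentiable (at x)"
  using assms has_derivative_transform_within_open unfolding differentiable_def by blast

lemma differentiable_times_on_cong:
  assumes "open U" "\<And>y. y \<in> U \<Longrightarrow> f y = g y" "differentiable_times_on n U f"
  shows "differentiable_times_on n U g"
  using assms(2,3)
proof (induction n arbitrary: f g)
  case 0
  then show ?case
    using continuous_on_cong by force
next
  case (Suc n)
  show ?case
  proof (simp, intro conjI ballI allI)
    show "g differentiable (at x)" if "x \<in> U" for x
      using differentiable_cong_open[OF assms(1) that Suc.prems(1)] Suc.prems(2) that by simp
    show "differentiable_times_on n U (dir_deriv v g)" for v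
    proof (rule Suc.IH)
      show "differentiable_times_on n U (dir_deriv v f)"
        using Suc.prems(2) by simp
      show "dir_deriv v f y = dir_deriv v g y" if "y \<in> U" for y
        using dir_deriv_cong[OF assms(1) that Suc.prems(1)] .
    qed
  qed
qed

lemma differentiable_times_on_SucD:
  "differentiable_times_on (Suc n) U f \<Longrightarrow> differentiable_times_on n U f"
proof (induction n arbitrary: f)
  case 0
  then show ?case
    by (auto intro!: continuous_at_imp_continuous_on differentiable_imp_continuous_within)
next
  case (Suc n)
  then show ?case
    by (metis differentiable_times_on.simps(2))
qed

section \<open>Closure properties of n times differentiable maps\<close>

lemma differentiable_times_on_linear:
  assumes T: "bounded_linear T" and U: "open U" and "differentiable_times_on n U f"
  shows "differentiable_times_on n U (\<lambda>x. T (f x))"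
  using assms(3)
proof (induction n arbitrary: f)
  case 0
  then show ?case
    using linear_continuous_on[OF T] by (auto intro: bounded_linear.continuous_on[OF T])
next
  case (Suc n)
  have D: "((\<lambda>x. T (f x)) has_derivative (\<lambda>v. T (dir_deriv v f x))) (at x)" if "x \<in> U" for x
    using Suc.prems that
    by (intro bounded_linear.has_derivative[OF T] has_derivative_dir_deriv) simp
  show ?case
  proof (simp, intro conjI ballI allI)
    show "(\<lambda>x. T (f x)) differentiable (at x)" if "x \<in> U" for x
      using D[OF that] by (rule differentiableI)
    show "differentiable_times_on n U (dir_deriv v (\<lambda>x. T (f x)))" for v
    proof (rule differentiable_times_on_cong[OF U])
      show "differentiable_times_on n U (\<lambda>x. T (dir_deriv v f x))"
        using Suc by simp
      show "T (dir_deriv v f y) = dir_deriv v (\<lambda>x. T (f x)) y" if "y \<in> U" for y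
        using dir_deriv_eq[OF D[OF that]] by simp
    qed
  qed
qed

lemma differentiable_times_on_add:
  assumes U: "open U" and "differentiable_times_on n U f" "differentiable_times_on n U g"
  shows "differentiable_times_on n U (\<lambda>x. f x + g x)"
  using assms(2,3)
proof (induction n arbitrary: f g)
  case 0
  then show ?case
    by (auto intro: continuous_on_add)
next
  case (Suc n)
  have D: "((\<lambda>x. f x + g x) has_derivative (\<lambda>v. dir_deriv v f x + dir_deriv v g x)) (at x)"
    if "x \<in> U" for x
    using Suc.prems that by (intro has_derivative_add has_derivative_dir_deriv) simp_all
  show ?case
  proof (simp, intro conjI ballI allI)
    show "(\<lambda>x. f x + g x) differentiable (at x)" if "x \<in> U" for x
      using D[OF that] by (rule differentiableI)
    show "differentiable_times_on n U (dir_deriv v (\<lambda>x. f x + g x))" for v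
    proof (rule differentiable_times_on_cong[OF U])
      show "differentiable_times_on n U (\<lambda>x. dir_deriv v f x + dir_deriv v g x)"
        using Suc by simp
      show "dir_deriv v f y + dir_deriv v g y = dir_deriv v (\<lambda>x. f x + g x) y" if "y \<in> U" for y
        using dir_deriv_eq[OF D[OF that]] by simp
    qed
  qed
qed

lemma differentiable_times_on_bilinear:
  assumes p: "bounded_bilinear p" and U: "open U"
    and "differentiable_times_on n U f" "differentiable_times_on n U g"
  shows "differentiable_times_on n U (\<lambda>x. p (f x) (g x))"
  using assms(3,4)
proof (induction n arbitrary: f g)
  case 0
  then show ?case
    by (auto intro: bounded_bilinear.continuous_on[OF p])
next
  case (Suc n)
  have D: "((\<lambda>x. p (f x) (g x)) has_derivative
      (\<lambda>v. p (f x) (dir_deriv v g x) + p (dir_deriv v f x) (g x))) (at x)" if "x \<in> U" for x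
    using Suc.prems that
    by (intro bounded_bilinear.FDERIV[OF p] has_derivative_dir_deriv) simp_all
  show ?case
  proof (simp, intro conjI ballI allI)
    show "(\<lambda>x. p (f x) (g x)) differentiable (at x)" if "x \<in> U" for x
      using D[OF that] by (rule differentiableI)
    show "differentiable_times_on n U (dir_deriv v (\<lambda>x. p (f x) (g x)))" for v
    proof (rule differentiable_times_on_cong[OF U])
      show "differentiable_times_on n U (\<lambda>x. p (f x) (dir_deriv v g x) + p (dir_deriv v f x) (g x))"
        using Suc.prems differentiable_times_on_SucD[OF Suc.prems(1)]
          differentiable_times_on_SucD[OF Suc.prems(2)]
        by (intro differentiable_times_on_add[OF U] Suc.IH) simp_all
      show "p (f y) (dir_deriv v g y) + p (dir_deriv v f y) (g y) = dir_deriv v (\<lambda>x. p (f x) (g x)) y"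
        if "y \<in> U" for y
        using dir_deriv_eq[OF D[OF that]] by simp
    qed
  qed
qed

text \<open>The derivative of 1/s is a product of 1/s, the derivative of s and 1/s. The induction
  keeps \<open>s\<close> fixed, its hypothesis covering the factors 1/s to one order less.\<close>

lemma differentiable_times_on_inverse:
  fixes s :: "'a::real_normed_vector \<Rightarrow> real"
  assumes U: "open U" and nz: "\<And>x. x \<in> U \<Longrightarrow> s x \<noteq> 0" and "differentiable_times_on n U s"
  shows "differentiable_times_on n U (\<lambda>x. inverse (s x))"
  using assms(3)
proof (induction n)
  case 0
  then show ?case
    using nz by (auto intro: continuous_on_inverse)
next
  case (Suc n)
  have D: "((\<lambda>x. inverse (s x)) has_derivative
      (\<lambda>v. - (inverse (s x) * dir_deriv v s x * inverse (s x)))) (at x)" if "x \<in> U" for x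
    using Suc.prems that nz
    by (intro Deriv.has_derivative_inverse has_derivative_dir_deriv) simp_all
  show ?case
  proof (simp, intro conjI ballI allI)
    show "(\<lambda>x. inverse (s x)) differentiable (at x)" if "x \<in> U" for x
      using D[OF that] by (rule differentiableI)
    show "differentiable_times_on n U (dir_deriv v (\<lambda>x. inverse (s x)))" for v
    proof (rule differentiable_times_on_cong[OF U])
      have "differentiable_times_on n U (\<lambda>x. inverse (s x))"
        using Suc.IH Suc.prems differentiable_times_on_SucD by blast
      then show "differentiable_times_on n U (\<lambda>x. - (inverse (s x) * dir_deriv v s x * inverse (s x)))"
        using Suc.prems
        by (intro differentiable_times_on_linear[OF bounded_linear_minus[OF bounded_linear_ident] U]
            differentiable_times_on_bilinear[OF bounded_bilinear_mult U]) simp_all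
      show "- (inverse (s y) * dir_deriv v s y * inverse (s y)) = dir_deriv v (\<lambda>x. inverse (s x)) y"
        if "y \<in> U" for y
        using dir_deriv_eq[OF D[OF that]] by simp
    qed
  qed
qed

section \<open>Derivatives and jets up to order three\<close>

lemma differentiable_times_on_3D:
  assumes "differentiable_times_on 3 U f" "x \<in> U"
  shows "(f has_derivative (\<lambda>v. dir_deriv v f x)) (at x)"
    and "(dir_deriv v f has_derivative (\<lambda>w. dir_deriv w (dir_deriv v f) x)) (at x)"
    and "(dir_deriv w (dir_deriv v f) has_derivative
          (\<lambda>z. dir_deriv z (dir_deriv w (dir_deriv v f)) x)) (at x)"
  using assms by (simp_all add: numeral_3_eq_3 has_derivative_dir_deriv)

lemma same_jet_3D:
  assumes "same_jet 3 f g x"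
  shows "f x = g x" "dir_deriv v f x = dir_deriv v g x"
    and "dir_deriv w (dir_deriv v f) x = dir_deriv w (dir_deriv v g) x"
    and "dir_deriv z (dir_deriv w (dir_deriv v f)) x = dir_deriv z (dir_deriv w (dir_deriv v g)) x"
  using assms by (simp_all add: numeral_3_eq_3)

text \<open>The Leibniz rule for the numerator of a map in an affine chart of projective space.\<close>
lemma homogeneous_leibniz:
  fixes T :: "'b::real_normed_vector \<Rightarrow> 'c::real_normed_vector" and l :: "'b \<Rightarrow> real"
  assumes T: "bounded_linear T" and l: "bounded_linear l" and U: "open U"
    and k: "differentiable_times_on 3 U k" and h: "differentiable_times_on 3 U h"
    and eq: "\<And>y. y \<in> U \<Longrightarrow> T (k y) = l (k y) *\<^sub>R h y"
    and x: "x \<in> U"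
  shows "T (dir_deriv v k x) = l (k x) *\<^sub>R dir_deriv v h x + l (dir_deriv v k x) *\<^sub>R h x" (is ?one)
    and "T (dir_deriv w (dir_deriv v k) x) =
      l (k x) *\<^sub>R dir_deriv w (dir_deriv v h) x
      + l (dir_deriv w k x) *\<^sub>R dir_deriv v h x
      + l (dir_deriv v k x) *\<^sub>R dir_deriv w h x
      + l (dir_deriv w (dir_deriv v k) x) *\<^sub>R h x" (is ?two)
    and "T (dir_deriv z (dir_deriv w (dir_deriv v k)) x) =
      l (k x) *\<^sub>R dir_deriv z (dir_deriv w (dir_deriv v h)) x
      + l (dir_deriv z k x) *\<^sub>R dir_deriv w (dir_deriv v h) x
      + l (dir_deriv w k x) *\<^sub>R dir_deriv z (dir_deriv v h) x
      + l (dir_deriv v k x) *\<^sub>R dir_deriv z (dir_deriv w h) x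
      + l (dir_deriv z (dir_deriv w k) x) *\<^sub>R dir_deriv v h x
      + l (dir_deriv z (dir_deriv v k) x) *\<^sub>R dir_deriv w h x
      + l (dir_deriv w (dir_deriv v k) x) *\<^sub>R dir_deriv z h x
      + l (dir_deriv z (dir_deriv w (dir_deriv v k)) x) *\<^sub>R h x" (is ?three)
proof -
  note Dk = differentiable_times_on_3D[OF k] and Dh = differentiable_times_on_3D[OF h]
  note DT = bounded_linear.has_derivative[OF T] and Dl = bounded_linear.has_derivative[OF l]
  \<comment> \<open>The first two identities are proved on all of \<open>U\<close> because each is
    differentiated to give the next. Mixed derivatives keep their order, so their symmetry is not
    invoked.\<close>
  have one: "T (dir_deriv v k x) = l (k x) *\<^sub>R dir_deriv v h x + l (dir_deriv v k x) *\<^sub>R h x"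
    if "x \<in> U" for x v
    using has_derivative_eq_on_open[OF U that eq DT[OF Dk(1)[OF that]]
        has_derivative_scaleR[OF Dl[OF Dk(1)[OF that]] Dh(1)[OF that]]] by simp
  have two: "T (dir_deriv w (dir_deriv v k) x) =
      l (k x) *\<^sub>R dir_deriv w (dir_deriv v h) x
      + l (dir_deriv w k x) *\<^sub>R dir_deriv v h x
      + l (dir_deriv v k x) *\<^sub>R dir_deriv w h x
      + l (dir_deriv w (dir_deriv v k) x) *\<^sub>R h x"
    if "x \<in> U" for x v w
    using has_derivative_eq_on_open[OF U that one DT[OF Dk(2)[OF that]]
        has_derivative_add[OF has_derivative_scaleR[OF Dl[OF Dk(1)[OF that]] Dh(2)[OF that]]
          has_derivative_scaleR[OF Dl[OF Dk(2)[OF that]] Dh(1)[OF that]]], of w v]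
    by (simp add: algebra_simps)
  have three: ?three
    using has_derivative_eq_on_open[OF U x two DT[OF Dk(3)[OF x]]
        has_derivative_add[OF has_derivative_add[OF has_derivative_add[OF
          has_derivative_scaleR[OF Dl[OF Dk(1)[OF x]] Dh(3)[OF x]]
          has_derivative_scaleR[OF Dl[OF Dk(2)[OF x]] Dh(2)[OF x]]]
          has_derivative_scaleR[OF Dl[OF Dk(2)[OF x]] Dh(2)[OF x]]]
          has_derivative_scaleR[OF Dl[OF Dk(3)[OF x]] Dh(1)[OF x]]], of z w v]
    by (simp add: algebra_simps)
  show ?one ?two ?three
    using one[OF x] two[OF x] three by blast+
qed

section \<open>The moving isometry is locally constant\<close>

text \<open>Differentiating the contact conditions of order 0, 1, 2 in the base point and comparing
  with those of order 1, 2, 3 shows that the derivative of \<open>G\<close> is compatible with 2-jets.\<close>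
lemma contact_isometry_derivative_zero:
  fixes G :: "real^2 \<Rightarrow> real^5^5" and f k :: "real^2 \<Rightarrow> real^5"
  assumes U: "open U"
    and G: "\<And>x. x \<in> U \<Longrightarrow> G x \<in> O41" "\<And>x. x \<in> U \<Longrightarrow> G differentiable (at x)"
    and f: "differentiable_times_on 3 U f" "\<And>x. x \<in> U \<Longrightarrow> f x $ 5 = 1"
      "\<And>x. x \<in> U \<Longrightarrow> mink (f x) (f x) = 0"
      "\<And>x. x \<in> U \<Longrightarrow> inj (frechet_derivative f (at x))"
    and k: "differentiable_times_on 3 U k"
    and h: "\<And>x. x \<in> U \<Longrightarrow> differentiable_times_on 3 U (h x)"
      "\<And>x y. x \<in> U \<Longrightarrow> y \<in> U \<Longrightarrow> G x *v k y = (G x *v k y) $ 5 *\<^sub>R h x y"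
    and jet: "\<And>x. x \<in> U \<Longrightarrow> same_jet 3 (h x) f x"
    and nz: "\<And>x. x \<in> U \<Longrightarrow> (G x *v k x) $ 5 \<noteq> 0"
    and x: "x \<in> U"
  shows "dir_deriv z G x = 0"
proof -
  have l: "bounded_linear (\<lambda>y. (A *v y) $ 5)" for A :: "real^5^5"
    by (intro bounded_linear_compose[OF bounded_linear_vec_nth] matrix_vector_mul_bounded_linear)
  \<comment> \<open>The fifth coordinate after applying \<open>G x\<close>: the homogeneous
    denominator in the affine chart.\<close>
  define s where "s = (\<lambda>x y. (G x *v y) $ 5)"
  note leibniz = homogeneous_leibniz[OF matrix_vector_mul_bounded_linear l U k]
  \<comment> \<open>In E0 to E3 the isometry is frozen at \<open>x\<close>, and the jet of
    \<open>h x\<close> at \<open>x\<close> is replaced by that of \<open>f\<close>. E0 to E2 hold at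
    every point of \<open>U\<close>, so they can be differentiated in the base point.\<close>
  have E0: "G x *v k x = s x (k x) *\<^sub>R f x" if "x \<in> U" for x
    using h(2)[OF that that] same_jet_3D(1)[OF jet[OF that]] by (simp add: s_def)
  have E1: "G x *v dir_deriv v k x =
      s x (k x) *\<^sub>R dir_deriv v f x + s x (dir_deriv v k x) *\<^sub>R f x" if "x \<in> U" for x v
    using leibniz(1)[OF h(1)[OF that] h(2)[OF that] that, of v]
    unfolding s_def same_jet_3D[OF jet[OF that]] by simp
  have E2: "G x *v dir_deriv w (dir_deriv v k) x =
      s x (k x) *\<^sub>R dir_deriv w (dir_deriv v f) x
      + s x (dir_deriv w k x) *\<^sub>R dir_deriv v f x
      + s x (dir_deriv v k x) *\<^sub>R dir_deriv w f x
      + s x (dir_deriv w (dir_deriv v k) x) *\<^sub>R f x" if "x \<in> U" for x v w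
    using leibniz(2)[OF h(1)[OF that] h(2)[OF that] that, of w v]
    unfolding s_def same_jet_3D[OF jet[OF that]] by simp
  have E3: "G x *v dir_deriv z (dir_deriv w (dir_deriv v k)) x =
      s x (k x) *\<^sub>R dir_deriv z (dir_deriv w (dir_deriv v f)) x
      + s x (dir_deriv z k x) *\<^sub>R dir_deriv w (dir_deriv v f) x
      + s x (dir_deriv w k x) *\<^sub>R dir_deriv z (dir_deriv v f) x
      + s x (dir_deriv v k x) *\<^sub>R dir_deriv z (dir_deriv w f) x
      + s x (dir_deriv z (dir_deriv w k) x) *\<^sub>R dir_deriv v f x
      + s x (dir_deriv z (dir_deriv v k) x) *\<^sub>R dir_deriv w f x
      + s x (dir_deriv w (dir_deriv v k) x) *\<^sub>R dir_deriv z f x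
      + s x (dir_deriv z (dir_deriv w (dir_deriv v k)) x) *\<^sub>R f x" for v w
    using leibniz(3)[OF h(1)[OF x] h(2)[OF x] x, of z w v]
    unfolding s_def same_jet_3D[OF jet[OF x]] by simp
  note Df = differentiable_times_on_3D[OF f(1) x] and Dk = differentiable_times_on_3D[OF k x]
  note DG = has_derivative_dir_deriv[OF G(2)[OF x]]
  note DGv = bounded_bilinear.FDERIV[OF matrix_vector_bounded_bilinear DG]
  have Ds: "((\<lambda>x. s x (u x)) has_derivative
      (\<lambda>z. s x (u' z) + (dir_deriv z G x *v u x) $ 5)) (at x)"
    if "(u has_derivative u') (at x)" for u u'
    using bounded_linear.has_derivative[OF bounded_linear_vec_nth[of 5] DGv[OF that]]
    unfolding s_def by simp
  define B where "B = dir_deriv z G x"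
  define e where "e = (\<lambda>v. dir_deriv v f x)"
  define q where "q = (\<lambda>v. dir_deriv v (dir_deriv v f) x)"
  \<comment> \<open>Differentiating E0 in the base point moves \<open>G\<close> too; subtracting E1,
    where \<open>G\<close> is frozen, leaves only terms with \<open>B\<close>. In the same way E1
    and E2 give \<open>B1\<close>, and E2 and E3 give \<open>B2\<close>.\<close>
  have B0: "B *v k x = (B *v k x) $ 5 *\<^sub>R f x"
    using has_derivative_eq_on_open[OF U x E0 DGv[OF Dk(1)]
        has_derivative_scaleR[OF Ds[OF Dk(1)] Df(1)], of z] E1[OF x, of z]
    by (simp add: B_def algebra_simps)
  have B1: "B *v dir_deriv v k x = (B *v k x) $ 5 *\<^sub>R e v + (B *v dir_deriv v k x) $ 5 *\<^sub>R f x" for v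
    using has_derivative_eq_on_open[OF U x E1 DGv[OF Dk(2)]
        has_derivative_add[OF has_derivative_scaleR[OF Ds[OF Dk(1)] Df(2)]
          has_derivative_scaleR[OF Ds[OF Dk(2)] Df(1)]], of z v] E2[OF x, of z v]
    by (simp add: B_def e_def algebra_simps)
  have B2: "B *v dir_deriv v (dir_deriv v k) x = (B *v k x) $ 5 *\<^sub>R q v
      + (2 * (B *v dir_deriv v k x) $ 5) *\<^sub>R e v + (B *v dir_deriv v (dir_deriv v k) x) $ 5 *\<^sub>R f x" for v
    using has_derivative_eq_on_open[OF U x E2 DGv[OF Dk(3)]
        has_derivative_add[OF has_derivative_add[OF has_derivative_add[OF
          has_derivative_scaleR[OF Ds[OF Dk(1)] Df(3)]
          has_derivative_scaleR[OF Ds[OF Dk(2)] Df(2)]]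
          has_derivative_scaleR[OF Ds[OF Dk(2)] Df(2)]]
          has_derivative_scaleR[OF Ds[OF Dk(3)] Df(1)]], of z v v] E3[of v v]
    by (simp add: B_def e_def q_def algebra_simps flip: scaleR_2)
  have lin_e: "linear e"
    using has_derivative_linear[OF Df(1)] by (simp add: e_def)
  have e_orth: "mink (dir_deriv v f y) (f y) = 0" if "y \<in> U" for v y
    using has_derivative_eq_on_open[OF U that f(3)
        mink.FDERIV[OF differentiable_times_on_3D(1)[OF f(1) that]
          differentiable_times_on_3D(1)[OF f(1) that]] has_derivative_const]
    by (simp add: mink_commute[of "f y"])
  \<comment> \<open>\<open>f\<close> stays in the hyperplane of fifth coordinate 1, so its tangent
    vectors are spatial and the form is definite on them.\<close>
  have e5: "e v $ 5 = 0" for v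
    using has_derivative_eq_on_open[OF U x f(2)
        bounded_linear.has_derivative[OF bounded_linear_vec_nth Df(1)] has_derivative_const]
    by (simp add: e_def)
  have e_nz: "mink (e v) (e v) \<noteq> 0" if "v \<noteq> 0" for v
  proof -
    have "e v \<noteq> e 0"
      using injD[OF f(4)[OF x], of v 0] that by (auto simp: e_def dir_deriv_def)
    then show ?thesis
      using mink_spatial_eq_0[OF e5] linear_0[OF lin_e] by simp
  qed
  have q_orth: "mink (q v) (f x) = - mink (e v) (e v)" for v
    using has_derivative_eq_on_open[OF U x e_orth mink.FDERIV[OF Df(2) Df(1)] has_derivative_const,
        of v v]
    by (simp add: e_def q_def)
  \<comment> \<open>The derivative of <G y a, G y b> = <a, b> for constant \<open>a\<close> and
    \<open>b\<close>.\<close>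
  have skew: "mink (B *v a) (G x *v b) + mink (G x *v a) (B *v b) = 0" for a b
  proof -
    have "((\<lambda>y. G y *v a) has_derivative (\<lambda>z. dir_deriv z G x *v a)) (at x)" for a
      using DGv[OF has_derivative_const[of a]] by simp
    from mink.FDERIV[OF this[of a] this[of b]] show ?thesis
      using has_derivative_eq_on_open[OF U x _ _ has_derivative_const,
          of "\<lambda>y. mink (G y *v a) (G y *v b)" "mink a b" _ z] G(1)
      by (simp add: B_def O41_def add.commute)
  qed
  have surj: "\<exists>w. G x *v w = y" for y
    using O41_inverse(3)[OF G(1)[OF x]] by (metis matrix_vector_mul_assoc matrix_vector_mul_lid)
  have "B = 0"
  proof (rule infinitesimal_rigidity[OF skew surj f(2)[OF x] f(3)[OF x] lin_e _ e_nz q_orth])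
    show "mink (e v) (f x) = 0" for v
      using e_orth[OF x] by (simp add: e_def)
    show "s x (k x) \<noteq> 0"
      using nz[OF x] by (simp add: s_def)
    show "G x *v k x = s x (k x) *\<^sub>R f x"
      by (rule E0[OF x])
    show "G x *v dir_deriv v k x = s x (k x) *\<^sub>R e v + s x (dir_deriv v k x) *\<^sub>R f x" for v
      using E1[OF x] by (simp add: e_def)
    show "G x *v dir_deriv v (dir_deriv v k) x = s x (k x) *\<^sub>R q v
        + (2 * s x (dir_deriv v k x)) *\<^sub>R e v + s x (dir_deriv v (dir_deriv v k) x) *\<^sub>R f x" for v
      using E2[OF x, of v v] by (simp add: e_def q_def algebra_simps flip: scaleR_2)
  qed (rule B0 B1 B2 | assumption)+
  then show ?thesis
    by (simp add: B_def)
qed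

section \<open>The projective light cone\<close>

lemma light_cone_nz: "v \<in> light_cone \<Longrightarrow> v $ 5 \<noteq> 0"
  using mink_spatial_eq_0 by (auto simp: light_cone_def)

lemma aff_span:
  assumes v: "v \<in> light_cone"
  shows "aff (span {v}) = inverse (v $ 5) *\<^sub>R v"
  unfolding aff_def
proof (rule the_equality)
  show "inverse (v $ 5) *\<^sub>R v \<in> span {v} \<and> (inverse (v $ 5) *\<^sub>R v) $ 5 = 1"
    using light_cone_nz[OF v] by (auto simp: span_singleton)
  fix w
  assume "w \<in> span {v} \<and> w $ 5 = 1"
  then obtain c where "w = c *\<^sub>R v" "c * v $ 5 = 1"
    unfolding span_singleton by force
  then show "w = inverse (v $ 5) *\<^sub>R v"
    using light_cone_nz[OF v] by (simp add: field_simps)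
qed

text \<open>\<open>span\<close> undoes \<open>aff\<close>, so \<open>aff\<close> is injective on the
  projective light cone.\<close>

lemma proj_light_cone_aff:
  assumes "l \<in> proj_light_cone"
  shows "aff l \<in> light_cone" "aff l $ 5 = 1" "span {aff l} = l"
proof -
  obtain v where v: "v \<in> light_cone" "l = span {v}"
    using assms by (auto simp: proj_light_cone_def)
  note nz = light_cone_nz[OF v(1)]
  have a: "aff l = inverse (v $ 5) *\<^sub>R v"
    by (simp add: v(2) aff_span[OF v(1)])
  show "aff l \<in> light_cone" "aff l $ 5 = 1"
    unfolding a using v(1) nz by (auto simp: light_cone_def mink.scaleR_left mink.scaleR_right)
  have "v = (v $ 5) *\<^sub>R aff l"
    using nz by (simp add: a)
  then have "v \<in> span {aff l}" "aff l \<in> span {v}"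
    using a by (auto simp: span_singleton)
  then show "span {aff l} = l"
    by (simp add: v(2) span_eq)
qed

lemma O41_light_cone:
  assumes "A \<in> O41" "v \<in> light_cone"
  shows "A *v v \<in> light_cone"
proof -
  have "mink_adjoint A *v (A *v v) = v"
    by (simp add: matrix_vector_mul_assoc O41_inverse(2)[OF assms(1)])
  then have "A *v v \<noteq> 0"
    using assms(2) by (auto simp: light_cone_def)
  then show ?thesis
    using assms by (simp add: light_cone_def O41_def)
qed

lemma act_span: "act A (span {v}) = span {A *v v}"
  using linear_span_image[of "(*v) A" "{v}"] by (simp add: act_def)

text \<open>In the affine chart the action is linear fractional, with a denominator that is nonzero
  because nonzero null vectors are never spatial.\<close>

lemma aff_act:
  assumes "A \<in> O41" "l \<in> proj_light_cone"
  shows "aff (act A l) = inverse ((A *v aff l) $ 5) *\<^sub>R (A *v aff l)"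
    and "(A *v aff l) $ 5 \<noteq> 0" "act A l \<in> proj_light_cone"
proof -
  have A: "A *v aff l \<in> light_cone"
    using O41_light_cone proj_light_cone_aff(1) assms by blast
  have l: "act A l = span {A *v aff l}"
    using act_span[of A "aff l"] proj_light_cone_aff(3)[OF assms(2)] by simp
  show "aff (act A l) = inverse ((A *v aff l) $ 5) *\<^sub>R (A *v aff l)"
    by (simp add: l aff_span[OF A])
  show "(A *v aff l) $ 5 \<noteq> 0"
    by (rule light_cone_nz[OF A])
  show "act A l \<in> proj_light_cone"
    using A by (auto simp: l proj_light_cone_def)
qed

section \<open>Rigidity\<close>

lemma contact_isometry_locally_constant:
  fixes \<A> :: "'a::{t2_space, second_countable_topology} chart set"
  assumes c: "c \<in> \<A>" "is_chart c" and p: "p \<in> fst c"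
    and F: "immersion_PL \<A> F" and Fhat: "smooth_map_PL \<A> Fhat"
    and g: "smooth_map \<A> g" "\<And>p. g p \<in> O41"
    and contact: "\<And>p. agree_to_order 3 \<A> (\<lambda>q. act (matrix_inv (g p)) (Fhat q)) F p"
  shows "\<exists>W. open W \<and> p \<in> W \<and> (\<forall>q\<in>W. g q = g p)"
proof -
  define U where "U = coord_range c"
  define \<phi> where "\<phi> = param c"
  define G where "G = (\<lambda>x. matrix_inv (g (\<phi> x)))"
  define f where "f = aff \<circ> F \<circ> \<phi>"
  define k where "k = aff \<circ> Fhat \<circ> \<phi>"
  \<comment> \<open>The deformation seen through the one group element \<open>G x\<close>; contact
    at \<open>x\<close> compares its 3-jet with that of \<open>f\<close>.\<close>
  define h where "h = (\<lambda>x. aff \<circ> (\<lambda>q. act (G x) (Fhat q)) \<circ> \<phi>)"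
  have open_c: "open (fst c)" and U: "open U"
    and homeo: "homeomorphism (fst c) U (snd c) \<phi>"
    using c(2) by (simp_all add: is_chart_def U_def \<phi>_def)
  have inv: "\<phi> x \<in> fst c" "snd c (\<phi> x) = x" if "x \<in> U" for x
    using homeo that by (auto simp: homeomorphism_def)
  have inv': "snd c q \<in> U" "\<phi> (snd c q) = q" if "q \<in> fst c" for q
    using homeo that by (auto simp: homeomorphism_def)
  have PL: "F p \<in> proj_light_cone" "Fhat p \<in> proj_light_cone" for p
    using F Fhat by (simp_all add: immersion_PL_def smooth_map_PL_def)
  have G_O41: "G x \<in> O41" for x
    by (simp add: G_def O41_matrix_inv g(2))
  have G_adj: "G = (\<lambda>x. mink_adjoint ((g \<circ> \<phi>) x))"
    by (simp add: G_def O41_inverse(1)[OF g(2)])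
  have smooth_f: "differentiable_times_on n U f" for n
    using F c(1) unfolding immersion_PL_def smooth_map_PL_def smooth_map_def smooth_on_def U_def f_def \<phi>_def
    by (simp add: comp_assoc)
  have smooth_k: "differentiable_times_on n U k" for n
    using Fhat c(1) unfolding smooth_map_PL_def smooth_map_def smooth_on_def U_def k_def \<phi>_def
    by (simp add: comp_assoc)
  have smooth_g: "differentiable_times_on n U (g \<circ> \<phi>)" for n
    using g(1) c(1) by (simp add: smooth_map_def smooth_on_def U_def \<phi>_def)
  have "differentiable_times_on 1 U G"
    unfolding G_adj by (rule differentiable_times_on_linear[OF bounded_linear_mink_adjoint U smooth_g])
  then have G_diff: "G differentiable (at x)" if "x \<in> U" for x
    using that by simp
  have l: "bounded_linear (\<lambda>y. (A *v y) $ 5)" for A :: "real^5^5"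
    by (intro bounded_linear_compose[OF bounded_linear_vec_nth] matrix_vector_mul_bounded_linear)
  have h_eq: "h x = (\<lambda>y. inverse ((G x *v k y) $ 5) *\<^sub>R (G x *v k y))" for x
    by (simp add: h_def k_def fun_eq_iff aff_act(1)[OF G_O41 PL(2)])
  have nz: "(G x *v k y) $ 5 \<noteq> 0" for x y
    by (simp add: k_def aff_act(2)[OF G_O41 PL(2)])
  have "dir_deriv z G x = 0" if "x \<in> U" for z x
  proof (rule contact_isometry_derivative_zero[OF U G_O41 G_diff smooth_f _ _ _ smooth_k _ _ _ _ that,
        where h = h])
    fix x y
    assume x: "x \<in> U"
    show "f x $ 5 = 1" "mink (f x) (f x) = 0"
      using proj_light_cone_aff(1,2)[OF PL(1)] by (simp_all add: f_def light_cone_def)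
    show "inj (frechet_derivative f (at x))"
      using F c(1) x by (simp add: immersion_PL_def U_def f_def \<phi>_def)
    show "differentiable_times_on 3 U (h x)"
      unfolding h_eq using nz
      by (intro differentiable_times_on_bilinear[OF bounded_bilinear_scaleR U]
          differentiable_times_on_inverse[OF U] differentiable_times_on_linear[OF l U smooth_k]
          differentiable_times_on_linear[OF matrix_vector_mul_bounded_linear U smooth_k])
    show "G x *v k y = (G x *v k y) $ 5 *\<^sub>R h x y"
      using nz by (simp add: h_eq)
    show "same_jet 3 (h x) f x"
      using contact[of "\<phi> x"] c(1) inv[OF x]
      by (force simp: agree_to_order_def h_def f_def G_def \<phi>_def)
    show "(G x *v k x) $ 5 \<noteq> 0"
      by (rule nz)
  qed
  then have DG: "(G has_derivative (\<lambda>z. 0)) (at x)" if "x \<in> U" for x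
    using has_derivative_dir_deriv[OF G_diff[OF that]] that by simp
  \<comment> \<open>A ball is convex, so vanishing of the derivative makes \<open>G\<close> constant
    on it.\<close>
  obtain r where r: "r > 0" "ball (snd c p) r \<subseteq> U"
    using U inv'(1)[OF p] open_contains_ball by blast
  have "(G has_derivative (\<lambda>z. 0)) (at x within ball (snd c p) r)" if "x \<in> ball (snd c p) r" for x
    using DG r(2) that by (blast intro: has_derivative_at_withinI)
  then obtain C where "\<And>x. x \<in> ball (snd c p) r \<Longrightarrow> G x = C"
    using has_derivative_zero_constant[OF convex_ball] by blast
  then have G_const: "G x = G (snd c p)" if "x \<in> ball (snd c p) r" for x
    using that r(1) by simp
  define W where "W = fst c \<inter> snd c -` ball (snd c p) r"
  have "open W"
    using homeo open_c by (auto simp: W_def homeomorphism_def intro!: continuous_open_preimage)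
  moreover have "p \<in> W"
    using p r(1) by (simp add: W_def)
  moreover have "g q = g p" if "q \<in> W" for q
  proof -
    have "matrix_inv (g q) = matrix_inv (g p)"
      using G_const[of "snd c q"] that p inv'(2) by (simp add: W_def G_def)
    then show ?thesis
      using O41_inverse[OF g(2)] by (metis matrix_mul_assoc matrix_mul_lid matrix_mul_rid)
  qed
  ultimately show ?thesis
    by blast
qed

theorem theorem4p7:
  fixes \<A> :: "'a::{t2_space, second_countable_topology} chart set"
    and F :: "'a \<Rightarrow> (real^5) set"
  assumes "smooth_surface \<A>"
    and "connected (UNIV :: 'a set)"
    and "immersion_PL \<A> F"
    and "umbilic_free \<A> F"
  shows "O41_rigid 3 \<A> F"
proof -
  have "trivial_deformation F Fhat" if deform: "O41_deformation 3 \<A> F Fhat" for Fhat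
  proof -
    obtain g where Fhat: "smooth_map_PL \<A> Fhat"
      and g: "smooth_map \<A> g" "\<And>p. g p \<in> O41"
      and contact: "\<And>p. agree_to_order 3 \<A> (\<lambda>q. act (matrix_inv (g p)) (Fhat q)) F p"
      using deform unfolding O41_deformation_def by blast
    have chart: "\<exists>c\<in>\<A>. is_chart c \<and> p \<in> fst c" for p
      using assms(1) by (auto simp: smooth_surface_def)
    have "g constant_on UNIV"
    proof (rule locally_constant_imp_constant[OF assms(2)])
      fix p
      obtain c where "c \<in> \<A>" "is_chart c" "p \<in> fst c"
        using chart by blast
      from contact_isometry_locally_constant[OF this assms(3) Fhat g contact]
      show "\<exists>T. openin (top_of_set UNIV) T \<and> p \<in> T \<and> (\<forall>q\<in>T. g q = g p)"
        by auto
    qed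
    then obtain A where A: "\<And>p. g p = A"
      by (auto simp: constant_on_def)
    have PL: "F p \<in> proj_light_cone" "Fhat p \<in> proj_light_cone" for p
      using assms(3) Fhat by (simp_all add: immersion_PL_def smooth_map_PL_def)
    have AO: "A \<in> O41"
      using g(2) A by metis
    have "Fhat p = act A (F p)" for p
    proof -
      obtain c where c: "c \<in> \<A>" "is_chart c" "p \<in> fst c"
        using chart by blast
      then have "param c (snd c p) = p"
        by (auto simp: is_chart_def homeomorphism_def)
      \<comment> \<open>With \<open>g\<close> constantly \<open>A\<close>, the order-zero part of
        contact at each \<open>p\<close> says that the inverse of \<open>A\<close> takes
        \<open>Fhat p\<close> to \<open>F p\<close>.\<close>
      with contact[of p] c have "aff (act (matrix_inv A) (Fhat p)) = aff (F p)"
        by (force simp: agree_to_order_def A dest: same_jet_3D(1))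
      then have "act (matrix_inv A) (Fhat p) = F p"
        using proj_light_cone_aff(3) PL aff_act(3)[OF O41_matrix_inv[OF AO]] by metis
      moreover have "act A (act (matrix_inv A) (Fhat p)) = Fhat p"
        by (simp add: act_def image_image matrix_vector_mul_assoc O41_inverse[OF AO])
      ultimately show ?thesis
        by simp
    qed
    with AO show ?thesis
      by (auto simp: trivial_deformation_def)
  qed
  then show ?thesis
    by (auto simp: O41_rigid_def)
qed

end
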